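(* Let $K$ be a convex body in $\mathbb{R}^n$, $n\ge 1$. Then, for every $a\in(0,1)$, $$\mathbb{E}_{\mu_K}\left[\exp\left(\frac{a}{n}\Lambda_K^*\right)\right]\ \leq\ 2^a\,\Gamma(1-a)\,n^a.$$ In particular, $\mathbb{E}_{\mu_K}\left[\exp\left(\frac{a}{n}\Lambda_K^*\right)\right]\leq C(a)\,n^a$ with $C(a)>0$ depending only on $a$.
   Context: A convex body in $\mathbb{R}^n$ is a compact convex set with non-empty interior; $\mu_K$ is the uniform probability measure on $K$, and $\mathbb{E}_{\mu_K}[f]=\int f\,d\mu_K$. $\Lambda_K^*(x)=\sup_{\theta\in\mathbb{R}^n}\{\langle\theta,x\rangle-\log\int e^{\langle\theta,y\rangle}\,d\mu_K(y)\}$ is the Cramér transform of $\mu_K$. $\Gamma$ is the Gamma function. *)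

theory Defs
  imports "HOL-Analysis.Analysis"
begin

definition convex_body :: "(real ^ 'n) set \<Rightarrow> bool" where
  "convex_body K \<longleftrightarrow> compact K \<and> convex K \<and> interior K \<noteq> {}"

definition unif :: "(real ^ 'n) set \<Rightarrow> (real ^ 'n) measure" where
  "unif K = uniform_measure lborel K"

text \<open>The integrand is continuous, hence bounded on a convex body \<open>K\<close>, so the Bochner integral
  below is the true value and is positive.\<close>

definition log_laplace :: "(real ^ 'n) set \<Rightarrow> real ^ 'n \<Rightarrow> real" where
  "log_laplace K \<theta> = ln (\<integral>y. exp (\<theta> \<bullet> y) \<partial>unif K)"

text \<open>The supremum is taken in the extended reals: it equals \<open>\<infinity>\<close> for \<open>x\<close> outside \<open>K\<close>, and may
  do so on the boundary of \<open>K\<close>.\<close>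

definition cramer_transform :: "(real ^ 'n) set \<Rightarrow> real ^ 'n \<Rightarrow> ereal" where
  "cramer_transform K x = (SUP \<theta>. ereal (\<theta> \<bullet> x - log_laplace K \<theta>))"

definition exp_ereal :: "ereal \<Rightarrow> ennreal" where
  "exp_ereal x =
     (if x = \<infinity> then \<infinity> else if x = -\<infinity> then 0 else ennreal (exp (real_of_ereal x)))"

text \<open>The expectation of \<open>exp ((a / n) \<Lambda>\<^sub>K\<^sup>*)\<close> as an extended nonnegative real, so that a finite upper
  bound includes the integrability of the function.\<close>

definition exp_moment :: "(real ^ 'n) set \<Rightarrow> real \<Rightarrow> ennreal" where
  "exp_moment K a =
     (\<integral>\<^sup>+x. exp_ereal (ereal (a / real CARD('n)) * cramer_transform K x) \<partial>unif K)"

text \<open>An explicit choice of the constant \<open>C(a)\<close>. A constant of type \<open>real \<Rightarrow> real\<close> depends neither on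
  the dimension, which is a type parameter, nor on the body.\<close>

definition moment_const :: "real \<Rightarrow> real" where
  "moment_const a = 2 powr a * Gamma (1 - a)"

text \<open>The integrand is Borel measurable, so \<open>nn_integral\<close> is the Lebesgue integral and not merely a
  lower integral.\<close>

lemma cramer_transform_measurable [measurable]: "cramer_transform K \<in> borel_measurable borel"
proof (rule borel_measurableI_greater)
  fix y :: ereal
  have "{x. y < cramer_transform K x} = (\<Union>\<theta>. {x. y < ereal (\<theta> \<bullet> x - log_laplace K \<theta>)})"
    by (auto simp: cramer_transform_def less_SUP_iff)
  moreover have "open (\<Union>\<theta>. {x. y < ereal (\<theta> \<bullet> x - log_laplace K \<theta>)})"
    by (intro open_UN ballI open_Collect_less continuous_intros)
  ultimately show "{x \<in> space borel. y < cramer_transform K x} \<in> sets borel"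
    by simp
qed

lemma exp_ereal_measurable [measurable]: "exp_ereal \<in> borel_measurable borel"
  unfolding exp_ereal_def[abs_def] by measurable

lemma exp_moment_integrand_measurable:
  "(\<lambda>x. exp_ereal (ereal c * cramer_transform K x)) \<in> borel_measurable (unif K)"
proof -
  have "(\<lambda>x. exp_ereal (ereal c * cramer_transform K x)) \<in> borel_measurable lborel"
    by measurable
  then show ?thesis
    by (simp add: unif_def measurable_cong_sets[OF sets_uniform_measure refl])
qed

end

theory Submission
  imports Defs
begin

text \<open>Near the boundary of \<open>K\<close> the Cramer transform grows at most like \<open>n\<close> times the logarithm of the
  reciprocal distance to the boundary, measured by the gauge of \<open>K\<close> about its barycenter \<open>b\<close>.

  For \<open>0 \<le> s < 1\<close> let \<open>K\<^sub>s = b + s (K - b)\<close>, and let \<open>x = (1 - s) b + s y\<close>, \<open>y \<in> K\<close>, be a point of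
  \<open>K\<^sub>s\<close>. By convexity \<open>K\<close> contains its contracted copy \<open>(1 - s) K + s y\<close>, which has barycenter \<open>x\<close>
  and relative volume \<open>(1 - s)\<^sup>n\<close>. Restricting the Laplace transform of \<open>\<mu>\<^sub>K\<close> to this copy and
  applying Jensen's inequality there gives
  \<open>\<integral> exp (\<theta> \<bullet> z) d\<mu>\<^sub>K(z) \<ge> (1 - s)\<^sup>n exp (\<theta> \<bullet> x)\<close> for every \<open>\<theta>\<close>, that is
  \<open>\<Lambda>\<^sub>K\<^sup>*(x) \<le> - n ln (1 - s)\<close>; this is lemma \<open>cramer_transform_le\<close>. Hence
  \<open>exp ((a / n) \<Lambda>\<^sub>K\<^sup>*(x)) \<le> (1 - t(x)) powr (- a)\<close>, where \<open>t(x)\<close> is the least \<open>s\<close> with \<open>x \<in> K\<^sub>s\<close>.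

  Since \<open>\<mu>\<^sub>K(K\<^sub>s) = s\<^sup>n\<close>, the function \<open>t\<close> has the density \<open>n s\<^bsup>n-1\<^esup>\<close> under \<open>\<mu>\<^sub>K\<close>, so the expectation
  is at most \<open>n B(n, 1 - a) = \<Gamma>(1 - a) \<Gamma>(n + 1) / \<Gamma>(n + 1 - a)\<close>. This is lemma
  \<open>exp_moment_le_Gamma_ratio\<close>; its proof goes through the tails of \<open>t\<close> instead of its density, by
  Tonelli's theorem for
  \<open>(1 - t) powr (- a) = 1 + \<integral>\<^sub>0\<^sup>1 a (1 - s) powr (- a - 1) 1[t > s] ds\<close>. Finally, log-convexity of
  \<open>\<Gamma>\<close> bounds the quotient \<open>\<Gamma>(n + 1) / \<Gamma>(n + 1 - a)\<close> by
  \<open>(n + 1 - a) powr a \<le> (2 n) powr a\<close>.\<close>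

section \<open>The uniform measure of a convex body\<close>

lemma convex_body_borel: "convex_body K \<Longrightarrow> K \<in> sets borel"
  by (simp add: convex_body_def borel_compact)

lemma emeasure_convex_body_finite: "convex_body K \<Longrightarrow> emeasure lborel K \<noteq> \<infinity>"
  unfolding convex_body_def using emeasure_compact_finite[of K] by auto

lemma emeasure_convex_body_pos:
  assumes "convex_body K"
  shows "emeasure lborel K \<noteq> 0"
proof
  assume "emeasure lborel K = 0"
  then have "K \<in> null_sets lborel"
    using convex_body_borel[OF assms] by auto
  then have "interior K \<in> null_sets lebesgue"
    using null_sets_subset[of K lebesgue "interior K"]
    by (simp add: interior_subset null_sets_completionI)
  then have "negligible (interior K)"
    by (simp add: negligible_iff_null_sets)
  then show False
    using assms open_not_negligible[of "interior K"] by (auto simp: convex_body_def)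
qed

lemma measure_convex_body_pos: "convex_body K \<Longrightarrow> 0 < measure lborel K"
  using emeasure_convex_body_pos[of K] emeasure_convex_body_finite[of K]
  by (simp add: measure_def enn2real_positive_iff less_top zero_less_iff_neq_zero)

lemma unif_eq_density:
  assumes "convex_body K"
  shows "unif K = density lborel (\<lambda>x. ennreal (indicator K x / measure lborel K))"
proof -
  have "(indicator K x :: ennreal) / emeasure lborel K
      = ennreal (indicator K x / measure lborel K)" for x
    using measure_convex_body_pos[OF assms] emeasure_convex_body_finite[OF assms]
    by (simp add: emeasure_eq_ennreal_measure divide_ennreal flip: ennreal_indicator)
  then show ?thesis
    unfolding unif_def uniform_measure_def by simp
qed

lemma integral_unif:
  fixes f :: "real ^ 'n \<Rightarrow> real"
  assumes "convex_body K" and "f \<in> borel_measurable borel"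
  shows "(\<integral>x. f x \<partial>unif K) = (\<integral>x. indicator K x * f x \<partial>lborel) / measure lborel K"
proof -
  have K: "K \<in> sets borel" "0 < measure lborel K"
    by (simp_all add: assms convex_body_borel measure_convex_body_pos)
  have "(\<integral>x. f x \<partial>unif K) = (\<integral>x. indicator K x / measure lborel K * f x \<partial>lborel)"
    unfolding unif_eq_density[OF assms(1)]
    by (subst integral_density) (use K assms in auto)
  also have "\<dots> = (\<integral>x. indicator K x * f x \<partial>lborel) / measure lborel K"
    by simp
  finally show ?thesis .
qed

lemma integrable_unif:
  fixes f :: "real ^ 'n \<Rightarrow> real"
  assumes "convex_body K" and "continuous_on UNIV f"
  shows "integrable (unif K) f"
proof -
  have K: "K \<in> sets borel" "0 < measure lborel K"
    by (simp_all add: assms convex_body_borel measure_convex_body_pos)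
  have f: "f \<in> borel_measurable borel"
    using assms(2) by (rule borel_measurable_continuous_onI)
  have "integrable lborel (\<lambda>x. indicator K x *\<^sub>R f x)"
    using assms by (intro borel_integrable_compact) (auto simp: convex_body_def intro: continuous_on_subset)
  then have "integrable lborel (\<lambda>x. indicator K x / measure lborel K * f x)"
    by (simp add: integrable_divide)
  then show ?thesis
    unfolding unif_eq_density[OF assms(1)]
    by (subst integrable_density) (use K f in auto)
qed

lemma prob_unif:
  "convex_body K \<Longrightarrow> emeasure (unif K) (space (unif K)) = 1"
  using emeasure_uniform_measure[of K lborel UNIV] emeasure_convex_body_pos[of K]
    emeasure_convex_body_finite[of K] convex_body_borel[of K]
  by (simp add: unif_def ennreal_divide_self less_top)

lemma AE_unif_mem: "convex_body K \<Longrightarrow> AE x in unif K. x \<in> K"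
  unfolding unif_def by (rule AE_uniform_measureI) (auto simp: convex_body_borel)

section \<open>Homothetic copies of a convex body\<close>

definition homothet :: "(real ^ 'n) set \<Rightarrow> real ^ 'n \<Rightarrow> real \<Rightarrow> (real ^ 'n) set" where
  "homothet K b s = (\<lambda>y. (1 - s) *\<^sub>R b + s *\<^sub>R y) ` K"

lemma compact_homothet: "compact K \<Longrightarrow> compact (homothet K b s)"
  unfolding homothet_def by (intro compact_continuous_image continuous_intros)

lemma emeasure_unif_homothet:
  fixes K :: "(real ^ 'n) set"
  assumes K: "convex_body K" and b: "b \<in> K" and s: "0 \<le> s" "s \<le> 1"
  shows "emeasure (unif K) (homothet K b s) = ennreal (s ^ CARD('n))"
proof -
  have "compact (homothet K b s)"
    using K by (intro compact_homothet) (simp add: convex_body_def)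
  then have B: "homothet K b s \<in> sets borel" by (rule borel_compact)
  have sub: "homothet K b s \<subseteq> K"
    using K b s by (auto simp: homothet_def convex_body_def convex_def)
  have "emeasure lborel (homothet K b s) = emeasure lebesgue (homothet K b s)"
    using B by simp
  also have "homothet K b s = (\<lambda>x. s *\<^sub>R x + (1 - s) *\<^sub>R b) ` K"
    by (simp add: homothet_def add.commute)
  also have "emeasure lebesgue \<dots> = ennreal (s ^ CARD('n)) * emeasure lborel K"
    using emeasure_lebesgue_affine[of s "(1 - s) *\<^sub>R b" K] convex_body_borel[OF K] s
    by (simp add: ennreal_power)
  finally have "emeasure lborel (homothet K b s) = ennreal (s ^ CARD('n)) * emeasure lborel K"
    by (simp add: homothet_def add.commute)
  moreover have "K \<inter> homothet K b s = homothet K b s" using sub by blast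
  ultimately show ?thesis
    using B convex_body_borel[OF K] emeasure_convex_body_finite[OF K] emeasure_convex_body_pos[OF K]
    by (simp add: unif_def ennreal_mult_divide_eq)
qed

lemma emeasure_unif_compl_homothet:
  fixes K :: "(real ^ 'n) set"
  assumes K: "convex_body K" and b: "b \<in> K" and s: "0 \<le> s" "s \<le> 1"
  shows "emeasure (unif K) (- homothet K b s) = ennreal (1 - s ^ CARD('n))"
proof -
  have "compact (homothet K b s)"
    using K by (intro compact_homothet) (simp add: convex_body_def)
  then have "homothet K b s \<in> sets (unif K)"
    by (simp add: unif_def borel_compact)
  then have "emeasure (unif K) (space (unif K) - homothet K b s) = 1 - ennreal (s ^ CARD('n))"
    using emeasure_unif_homothet[OF assms] prob_unif[OF K] by (subst emeasure_compl) auto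
  then show ?thesis
    using s by (simp add: unif_def Compl_eq_Diff_UNIV ennreal_minus flip: ennreal_1)
qed

text \<open>The copies are collected in one compact set, so that joint measurability in \<open>(s, x)\<close> and
  closedness of \<open>{s. x \<in> homothet K b s}\<close> come from a single argument.\<close>

definition homothets_graph :: "(real ^ 'n) set \<Rightarrow> real ^ 'n \<Rightarrow> (real \<times> (real ^ 'n)) set" where
  "homothets_graph K b = (\<lambda>(s, y). (s, (1 - s) *\<^sub>R b + s *\<^sub>R y)) ` ({0..1} \<times> K)"

lemma mem_homothets_graph:
  "(s, x) \<in> homothets_graph K b \<longleftrightarrow> 0 \<le> s \<and> s \<le> 1 \<and> x \<in> homothet K b s"
  by (auto simp: homothets_graph_def homothet_def)

lemma compact_homothets_graph:
  assumes "compact K"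
  shows "compact (homothets_graph K b)"
  unfolding homothets_graph_def case_prod_unfold
  by (intro compact_continuous_image compact_Times assms compact_Icc continuous_intros)

section \<open>The Cramer transform on homothetic copies\<close>

text \<open>The right-hand integral dominates the integral over the contracted copy of \<open>K\<close> inside \<open>K\<close>; the
  factor \<open>r ^ n\<close> is the Jacobian of the contraction onto it.\<close>

lemma integral_unif_contraction_le:
  fixes f :: "real ^ 'n \<Rightarrow> real"
  assumes K: "convex_body K" and y: "y \<in> K" and r: "0 < r" "r \<le> 1"
    and f: "continuous_on UNIV f" "\<And>x. 0 \<le> f x"
  shows "r ^ CARD('n) * (\<integral>z. f ((1 - r) *\<^sub>R y + r *\<^sub>R z) \<partial>unif K) \<le> (\<integral>x. f x \<partial>unif K)"
proof -
  let ?T = "\<lambda>z. (1 - r) *\<^sub>R y + r *\<^sub>R z"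
  have fm [measurable]: "f \<in> borel_measurable borel"
    using f(1) by (rule borel_measurable_continuous_onI)
  have [measurable]: "K \<in> sets borel" by (rule convex_body_borel[OF K])
  have TK: "?T z \<in> K" if "z \<in> K" for z
    using K y r that by (auto simp: convex_body_def convex_def)
  have int: "integrable lborel (\<lambda>x. indicator K x * f x)"
    using borel_integrable_compact[of K f] K f(1)
    by (auto simp: convex_body_def intro: continuous_on_subset)
  have intT: "integrable lborel (\<lambda>z. indicator K z * f (?T z))"
    using borel_integrable_compact[of K "\<lambda>z. f (?T z)"] K
      continuous_on_compose2[OF f(1), of K ?T]
    by (auto simp: convex_body_def continuous_intros)
  \<comment> \<open>Substituting along \<open>?T\<close> means rewriting Lebesgue measure as a rescaled image of itself.\<close>
  have aff: "(lborel :: (real ^ 'n) measure)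
      = density (distr lborel borel ?T) (\<lambda>_. ennreal (r ^ CARD('n)))"
    using lborel_affine[of r "(1 - r) *\<^sub>R y"] r by (simp add: ennreal_power)
  have "integrable (density (distr lborel borel ?T) (\<lambda>_. ennreal (r ^ CARD('n))))
      (\<lambda>x. indicator K x * f x)"
    using int by (simp flip: aff)
  then have "integrable (distr lborel borel ?T) (\<lambda>x. r ^ CARD('n) * (indicator K x * f x))"
    using r by (subst (asm) integrable_density) auto
  then have "integrable lborel (\<lambda>z. r ^ CARD('n) * (indicator K (?T z) * f (?T z)))"
    by (subst (asm) integrable_distr_eq) auto
  then have intKT: "integrable lborel (\<lambda>z. indicator K (?T z) * f (?T z))"
    using r by simp
  have "(\<integral>x. indicator K x * f x \<partial>lborel)
      = (\<integral>x. indicator K x * f x \<partial>density (distr lborel borel ?T) (\<lambda>_. ennreal (r ^ CARD('n))))"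
    by (simp flip: aff)
  also have "\<dots> = (\<integral>x. r ^ CARD('n) * (indicator K x * f x) \<partial>distr lborel borel ?T)"
    using r by (subst integral_density) auto
  also have "\<dots> = r ^ CARD('n) * (\<integral>z. indicator K (?T z) * f (?T z) \<partial>lborel)"
    by (subst integral_distr) auto
  also have "\<dots> \<ge> r ^ CARD('n) * (\<integral>z. indicator K z * f (?T z) \<partial>lborel)"
    using r f(2) TK
    by (intro mult_left_mono integral_mono intT intKT) (auto split: split_indicator)
  finally have "r ^ CARD('n) * (\<integral>z. indicator K z * f (?T z) \<partial>lborel)
      \<le> (\<integral>x. indicator K x * f x \<partial>lborel)" .
  then show ?thesis
    using measure_convex_body_pos[OF K]
    by (simp add: integral_unif[OF K] divide_right_mono)
qed

definition barycenter :: "(real ^ 'n) set \<Rightarrow> real ^ 'n" where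
  "barycenter K = (\<chi> i. \<integral>x. x $ i \<partial>unif K)"

lemma integral_inner_unif:
  assumes "convex_body K"
  shows "(\<integral>x. \<theta> \<bullet> x \<partial>unif K) = \<theta> \<bullet> barycenter K"
proof -
  have "integrable (unif K) (\<lambda>x. \<theta> $ i * x $ i)" for i
    by (intro integrable_unif assms continuous_intros)
  then show ?thesis
    by (simp add: inner_vec_def barycenter_def integral_sum)
qed

text \<open>A linear functional that is larger than \<open>c\<close> on all of \<open>K\<close> has a mean at least \<open>c\<close>, so no
  hyperplane can strictly separate the barycenter from \<open>K\<close>.\<close>

lemma barycenter_mem:
  assumes K: "convex_body K"
  shows "barycenter K \<in> K"
proof (rule ccontr)
  assume "barycenter K \<notin> K"
  then obtain \<theta> c where sep: "\<theta> \<bullet> barycenter K < c" "\<And>x. x \<in> K \<Longrightarrow> c < \<theta> \<bullet> x"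
    using separating_hyperplane_closed_point[of K "barycenter K"] K
    by (auto simp: convex_body_def compact_imp_closed)
  have m: "measure (unif K) (space (unif K)) = 1"
    by (simp add: measure_def prob_unif[OF K])
  have "c = (\<integral>x. c \<partial>unif K)"
    using m by simp
  also have "\<dots> \<le> (\<integral>x. \<theta> \<bullet> x \<partial>unif K)"
    using AE_unif_mem[OF K] sep(2)
    by (intro integral_mono_AE integrable_unif K continuous_intros) (auto intro: less_imp_le)
  finally show False
    using sep(1) by (simp add: integral_inner_unif[OF K])
qed

text \<open>The contracted copy \<open>(1 - s) K + s y\<close> of \<open>K\<close> has barycenter \<open>x\<close>, and Jensen's inequality for
  the exponential on that copy is the integrated tangent bound \<open>1 + u \<le> exp u\<close>, whose linear term
  vanishes.\<close>

lemma cramer_transform_le: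
  fixes K :: "(real ^ 'n) set"
  assumes K: "convex_body K" and s: "0 \<le> s" "s < 1"
    and x: "x \<in> homothet K (barycenter K) s"
  shows "cramer_transform K x \<le> ereal (- real CARD('n) * ln (1 - s))"
  unfolding cramer_transform_def
proof (rule SUP_least)
  fix \<theta> :: "real ^ 'n"
  let ?b = "barycenter K" and ?r = "1 - s"
  obtain y where y: "y \<in> K" "x = ?r *\<^sub>R ?b + s *\<^sub>R y"
    using x by (auto simp: homothet_def)
  let ?f = "\<lambda>z. exp (\<theta> \<bullet> z)" and ?T = "\<lambda>z. (1 - ?r) *\<^sub>R y + ?r *\<^sub>R z"
  have m: "measure (unif K) (space (unif K)) = 1"
    by (simp add: measure_def prob_unif[OF K])
  have int: "integrable (unif K) f" if "continuous_on UNIV f" for f :: "real ^ 'n \<Rightarrow> real"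
    using K that by (rule integrable_unif)
  have lin: "exp (\<theta> \<bullet> x) * (1 + ?r * (\<theta> \<bullet> z - \<theta> \<bullet> ?b)) \<le> ?f (?T z)" for z
  proof -
    have "?f (?T z) = exp (\<theta> \<bullet> x) * exp (?r * (\<theta> \<bullet> z - \<theta> \<bullet> ?b))"
      by (simp add: y(2) inner_add_right flip: exp_add) (simp add: algebra_simps)
    then show ?thesis by (simp add: exp_ge_add_one_self)
  qed
  have "exp (\<theta> \<bullet> x) = (\<integral>z. exp (\<theta> \<bullet> x) * (1 + ?r * (\<theta> \<bullet> z - \<theta> \<bullet> ?b)) \<partial>unif K)"
    using m int[of "\<lambda>z. \<theta> \<bullet> z"] int[of "\<lambda>z. 1"] int[of "\<lambda>z. \<theta> \<bullet> ?b"] integral_inner_unif[OF K, of \<theta>]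
    by (simp add: continuous_intros)
  also have "\<dots> \<le> (\<integral>z. ?f (?T z) \<partial>unif K)"
    by (intro integral_mono int lin continuous_intros)
  finally have "?r ^ CARD('n) * exp (\<theta> \<bullet> x) \<le> ?r ^ CARD('n) * (\<integral>z. ?f (?T z) \<partial>unif K)"
    using s by (simp add: mult_left_mono)
  also have "\<dots> \<le> (\<integral>z. ?f z \<partial>unif K)"
    using s by (intro integral_unif_contraction_le K y) (auto intro!: continuous_intros)
  finally have le: "?r ^ CARD('n) * exp (\<theta> \<bullet> x) \<le> (\<integral>z. ?f z \<partial>unif K)" .
  moreover have "0 < ?r ^ CARD('n) * exp (\<theta> \<bullet> x)"
    using s by simp
  ultimately have "ln (?r ^ CARD('n) * exp (\<theta> \<bullet> x)) \<le> log_laplace K \<theta>"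
    unfolding log_laplace_def by (subst ln_le_cancel_iff) auto
  moreover have "ln (?r ^ CARD('n) * exp (\<theta> \<bullet> x)) = real CARD('n) * ln ?r + \<theta> \<bullet> x"
    using s by (simp add: ln_mult ln_realpow)
  ultimately show "ereal (\<theta> \<bullet> x - log_laplace K \<theta>) \<le> ereal (- real CARD('n) * ln ?r)"
    by simp
qed

section \<open>Gamma and Beta integrals\<close>

text \<open>Both sides equal \<open>n B(n, 1 - a)\<close> for \<open>n > 0\<close>. The induction rests on
  \<open>\<Gamma>(x + 1) / \<Gamma>(x + 1 - a) - \<Gamma>(x) / \<Gamma>(x - a) = a \<Gamma>(x) / \<Gamma>(x + 1 - a)\<close>.\<close>

lemma sum_Beta_telescope:
  fixes a :: real
  assumes "0 < a" "a < 1"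
  shows "1 + a * (\<Sum>k<n. Beta (real k + 1) (1 - a))
    = Gamma (1 - a) * Gamma (real n + 1) / Gamma (real n + 1 - a)"
proof (induction n)
  case 0
  have "0 < Gamma (1 - a)"
    using assms by (intro Gamma_real_pos) auto
  then show ?case using Gamma_1 by simp
next
  case (Suc n)
  let ?x = "real n + 1"
  have pos: "0 < Gamma (?x - a)" using assms by (intro Gamma_real_pos) auto
  have G1: "Gamma (?x + 1) = ?x * Gamma ?x"
    by (rule Gamma_plus1) (auto elim!: nonpos_Ints_cases)
  have G2: "Gamma (?x - a + 1) = (?x - a) * Gamma (?x - a)"
    by (rule Gamma_plus1) (use assms in \<open>auto elim!: nonpos_Ints_cases'\<close>)
  have x: "?x - a > 0" using assms by simp
  have "1 + a * (\<Sum>k<Suc n. Beta (real k + 1) (1 - a))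
      = Gamma (1 - a) * Gamma ?x / Gamma (?x - a) + a * Beta ?x (1 - a)"
    using Suc.IH by (simp add: algebra_simps)
  also have "Beta ?x (1 - a) = Gamma ?x * Gamma (1 - a) / Gamma (?x - a + 1)"
    by (simp add: Beta_def algebra_simps)
  also have "Gamma (1 - a) * Gamma ?x / Gamma (?x - a) + a * (Gamma ?x * Gamma (1 - a) / Gamma (?x - a + 1))
     = Gamma (1 - a) * Gamma (?x + 1) / Gamma (?x - a + 1)"
    unfolding G1 G2 using pos x by (simp add: divide_simps) (simp add: algebra_simps)
  finally show ?case by (simp add: algebra_simps)
qed

text \<open>The point \<open>x + a\<close> divides the interval from \<open>x\<close> to \<open>x + 1\<close> in the ratio \<open>a : 1 - a\<close>, and
  \<open>\<Gamma>(x + 1) = x \<Gamma>(x)\<close>; so this is log-convexity of \<open>\<Gamma>\<close>.\<close>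

lemma Gamma_ratio_le:
  fixes a x :: real
  assumes "0 < a" "a < 1" "0 < x"
  shows "Gamma (x + a) \<le> x powr a * Gamma x"
proof -
  have p: "0 < Gamma x" "0 < Gamma (x + 1)" "0 < Gamma (x + a)"
    using assms by (simp_all add: Gamma_real_pos)
  have G: "Gamma (x + 1) = x * Gamma x"
    by (rule Gamma_plus1) (use assms in \<open>auto elim!: nonpos_Ints_cases'\<close>)
  have "(ln \<circ> Gamma) ((1 - a) *\<^sub>R x + a *\<^sub>R (x + 1))
      \<le> (1 - a) * (ln \<circ> Gamma) x + a * (ln \<circ> Gamma) (x + 1)"
    using assms by (intro convex_onD[OF log_convex_Gamma_real]) auto
  moreover have "(1 - a) *\<^sub>R x + a *\<^sub>R (x + 1) = x + a"
    by (simp add: algebra_simps)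
  ultimately have "ln (Gamma (x + a)) \<le> ln (Gamma x) + a * ln x"
    using assms p by (simp add: G ln_mult) (simp add: algebra_simps)
  also have "\<dots> = ln (x powr a * Gamma x)"
    using ln_mult[of "x powr a" "Gamma x"] assms p by (simp add: ln_powr)
  finally show ?thesis
    using p assms by (subst (asm) ln_le_cancel_iff) auto
qed

text \<open>The layer-cake representation of \<open>(1 - t) powr (- a)\<close>.\<close>

lemma nn_integral_powr_tail:
  fixes a t :: real
  assumes "0 < a" "0 \<le> t" "t < 1"
  shows "1 + (\<integral>\<^sup>+s. ennreal (a * (1 - s) powr (- a - 1)) * indicator {0<..<t} s \<partial>lborel)
    = ennreal ((1 - t) powr (- a))"
proof -
  have "((\<lambda>s. a * (1 - s) powr (- a - 1)) has_integral
      (1 - t) powr (- a) - (1 - 0) powr (- a)) {0..t}"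
    using assms
    by (intro fundamental_theorem_of_calculus)
      (auto intro!: derivative_eq_intros simp flip: has_real_derivative_iff_has_vector_derivative)
  then have I: "((\<lambda>s. a * (1 - s) powr (- a - 1)) has_integral (1 - t) powr (- a) - 1) {0<..<t}"
    by (simp add: has_integral_Icc_iff_Ioo)
  have ge: "1 \<le> (1 - t) powr (- a)"
    using assms powr_mono2'[of "- a" "1 - t" 1] by simp
  show ?thesis
    using nn_integral_has_integral_lebesgue'[OF _ I] assms ge
    by (simp flip: ennreal_1 ennreal_plus)
qed

text \<open>The geometric sum \<open>1 - s ^ n = (1 - s) (\<Sum>k<n. s ^ k)\<close> cancels the singularity that makes
  \<open>(1 - s) powr (- a - 1)\<close> non-integrable at \<open>1\<close>, and leaves Beta integrals.\<close>

lemma nn_integral_powr_one_minus_power: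
  fixes a :: real
  assumes a: "0 < a" "a < 1"
  shows "(\<integral>\<^sup>+s. ennreal (a * (1 - s) powr (- a - 1)) * indicator {0<..<1} s
      * ennreal (1 - s ^ n) \<partial>lborel) = ennreal (a * (\<Sum>k<n. Beta (real k + 1) (1 - a)))"
proof -
  have "((\<lambda>s. s powr real k * (1 - s) powr (- a)) has_integral Beta (real k + 1) (1 - a)) {0<..<1}" for k
    using has_integral_Beta_real[of "real k + 1" "1 - a"] a by (simp add: has_integral_Icc_iff_Ioo)
  then have "((\<lambda>s. a * (\<Sum>k<n. s powr real k * (1 - s) powr (- a))) has_integral
      a * (\<Sum>k<n. Beta (real k + 1) (1 - a))) {0<..<1}"
    by (intro has_integral_mult_right has_integral_sum) auto
  moreover have "a * (\<Sum>k<n. s powr real k * (1 - s) powr (- a))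
      = a * (1 - s) powr (- a - 1) * (1 - s ^ n)" if "s \<in> {0<..<1}" for s
  proof -
    have "(1 - s) powr (- a) = (1 - s) powr (- a - 1) * (1 - s)"
      using that powr_add[of "1 - s" "- a - 1" 1] by simp
    then show ?thesis
      using that by (simp add: powr_realpow one_diff_power_eq sum_distrib_left sum_distrib_right mult_ac)
  qed
  ultimately have I: "((\<lambda>s. a * (1 - s) powr (- a - 1) * (1 - s ^ n)) has_integral
      a * (\<Sum>k<n. Beta (real k + 1) (1 - a))) {0<..<1}"
    by (subst (asm) has_integral_cong) auto
  have "(\<integral>\<^sup>+s. ennreal (a * (1 - s) powr (- a - 1)) * indicator {0<..<1} s * ennreal (1 - s ^ n) \<partial>lborel)
      = (\<integral>\<^sup>+s. ennreal (a * (1 - s) powr (- a - 1) * (1 - s ^ n)) * indicator {0<..<1} s \<partial>lborel)"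
    using a by (intro nn_integral_cong) (auto split: split_indicator simp: ennreal_mult' power_le_one)
  also have "\<dots> = ennreal (a * (\<Sum>k<n. Beta (real k + 1) (1 - a)))"
    using a by (intro nn_integral_has_integral_lebesgue' I) (auto simp: power_le_one)
  finally show ?thesis .
qed

section \<open>The exponential moment\<close>

lemma exp_ereal_le: "x \<le> ereal r \<Longrightarrow> exp_ereal x \<le> ennreal (exp r)"
  by (cases x) (auto simp: exp_ereal_def ennreal_leI)

text \<open>Let \<open>t\<close> be the least \<open>s\<close> with \<open>x\<close> in the copy of ratio \<open>s\<close>. The left-hand side is at most
  \<open>(1 - t) powr (- a)\<close>, and the right-hand side is the layer-cake form of that number. For \<open>t = 1\<close>,
  which occurs on the boundary of \<open>K\<close>, the right-hand side is infinite.\<close>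

lemma exp_cramer_le_nn_integral:
  fixes K :: "(real ^ 'n) set"
  assumes K: "convex_body K" and x: "x \<in> K" and a: "0 < a"
  shows "exp_ereal (ereal (a / real CARD('n)) * cramer_transform K x)
    \<le> 1 + (\<integral>\<^sup>+s. ennreal (a * (1 - s) powr (- a - 1)) * indicator {0<..<1} s
          * indicator (- homothets_graph K (barycenter K)) (s, x) \<partial>lborel)"
    (is "?E \<le> 1 + ?I")
proof -
  let ?G = "homothets_graph K (barycenter K)" and ?n = "real CARD('n)"
  define S where "S = {s. (s, x) \<in> ?G}"
  define t where "t = Inf S"
  have "closed ((\<lambda>s. (s, x)) -` ?G)"
    using K by (intro closed_vimage compact_imp_closed compact_homothets_graph continuous_intros)
      (auto simp: convex_body_def)
  then have clS: "closed S" by (simp add: S_def vimage_def)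
  have S1: "1 \<in> S" and S01: "S \<subseteq> {0..1}"
    using x by (auto simp: S_def mem_homothets_graph homothet_def)
  have bdd: "bdd_below S" using S01 by (meson bdd_below_Icc bdd_below_mono)
  have tS: "t \<in> S"
    unfolding t_def using clS S1 bdd by (intro closed_contains_Inf) auto
  then have t01: "0 \<le> t" "t \<le> 1" using S01 by auto
  have below: "(s, x) \<notin> ?G" if "s < t" for s
    using that cInf_lower[OF _ bdd, of s] by (auto simp: S_def t_def)
  have lower: "ennreal ((1 - u) powr (- a)) \<le> 1 + ?I" if u: "0 \<le> u" "u \<le> t" "u < 1" for u
    unfolding nn_integral_powr_tail[OF a u(1,3), symmetric]
    by (intro add_left_mono nn_integral_mono)
      (use u t01 below in \<open>auto split: split_indicator\<close>)
  show ?thesis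
  proof (cases "t < 1")
    case True
    have "cramer_transform K x \<le> ereal (- ?n * ln (1 - t))"
      using True t01 tS by (intro cramer_transform_le K) (auto simp: S_def mem_homothets_graph)
    then have "ereal (a / ?n) * cramer_transform K x \<le> ereal (a / ?n) * ereal (- ?n * ln (1 - t))"
      using a by (intro ereal_mult_left_mono) auto
    also have "\<dots> = ereal (- a * ln (1 - t))"
      by simp
    finally have "?E \<le> ennreal (exp (- a * ln (1 - t)))"
      by (rule exp_ereal_le)
    also have "exp (- a * ln (1 - t)) = (1 - t) powr (- a)"
      using True by (simp add: powr_def)
    also have "ennreal \<dots> \<le> 1 + ?I"
      using True t01 by (intro lower) auto
    finally show ?thesis .
  next
    case False
    have "1 + ?I = \<infinity>"
    proof (rule ccontr)
      assume "1 + ?I \<noteq> \<infinity>"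
      then obtain r where r: "0 \<le> r" "1 + ?I = ennreal r"
        by (cases "1 + ?I") auto
      \<comment> \<open>chosen so that \<open>(1 - u) powr (- a) = r + 1\<close>\<close>
      define u where "u = 1 - (r + 1) powr (- 1 / a)"
      have "(r + 1) powr (- 1 / a) \<le> 1"
        using r a powr_mono[of "- 1 / a" 0 "r + 1"] by auto
      moreover have "0 < (r + 1) powr (- 1 / a)" using r by simp
      ultimately have "0 \<le> u" "u < 1" by (auto simp: u_def)
      then have "ennreal ((1 - u) powr (- a)) \<le> ennreal r"
        using lower[of u] False r by simp
      moreover have "(1 - u) powr (- a) = r + 1"
        using r a by (simp add: u_def powr_powr)
      ultimately show False
        using r by simp
    qed
    then show ?thesis by simp
  qed
qed

text \<open>Integrating the pointwise bound over \<open>K\<close> and exchanging the integrals turns the indicator into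
  the volume \<open>1 - s ^ n\<close> of the complement of a homothetic copy.\<close>

lemma exp_moment_le_Gamma_ratio:
  fixes K :: "(real ^ 'n) set"
  assumes K: "convex_body K" and a: "0 < a" "a < 1"
  shows "exp_moment K a
    \<le> ennreal (Gamma (1 - a) * Gamma (real CARD('n) + 1) / Gamma (real CARD('n) + 1 - a))"
proof -
  let ?b = "barycenter K" and ?n = "CARD('n)"
  let ?G = "homothets_graph K ?b"
  let ?w = "\<lambda>s. ennreal (a * (1 - s) powr (- a - 1)) * indicator {0<..<1} s"
  interpret U: finite_measure "unif K"
    by (rule finite_measureI) (simp add: prob_unif[OF K])
  interpret P: pair_sigma_finite "unif K" "lborel :: real measure" ..
  have setsU [measurable_cong]: "sets (unif K) = sets borel" by (simp add: unif_def)
  have [measurable]: "?G \<in> sets (borel \<Otimes>\<^sub>M borel)"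
    unfolding borel_prod
    using K by (intro borel_compact compact_homothets_graph) (auto simp: convex_body_def)
  have m: "(\<lambda>(x, s). ?w s * indicator (- ?G) (s, x)) \<in> borel_measurable (unif K \<Otimes>\<^sub>M lborel)"
    by measurable
  have "exp_moment K a \<le> (\<integral>\<^sup>+x. 1 + (\<integral>\<^sup>+s. ?w s * indicator (- ?G) (s, x) \<partial>lborel) \<partial>unif K)"
    unfolding exp_moment_def
    using AE_unif_mem[OF K]
    by (intro nn_integral_mono_AE) (auto elim!: eventually_mono intro!: exp_cramer_le_nn_integral K a)
  also have "\<dots> = 1 + (\<integral>\<^sup>+x. \<integral>\<^sup>+s. ?w s * indicator (- ?G) (s, x) \<partial>lborel \<partial>unif K)"
    using m prob_unif[OF K] by (subst nn_integral_add) (auto intro: lborel.borel_measurable_nn_integral)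
  also have "(\<integral>\<^sup>+x. \<integral>\<^sup>+s. ?w s * indicator (- ?G) (s, x) \<partial>lborel \<partial>unif K)
      = (\<integral>\<^sup>+s. \<integral>\<^sup>+x. ?w s * indicator (- ?G) (s, x) \<partial>unif K \<partial>lborel)"
    by (rule P.Fubini'[OF m, symmetric])
  also have "\<dots> = (\<integral>\<^sup>+s. ?w s * ennreal (1 - s ^ ?n) \<partial>lborel)"
  proof (rule nn_integral_cong)
    fix s :: real
    show "(\<integral>\<^sup>+x. ?w s * indicator (- ?G) (s, x) \<partial>unif K) = ?w s * ennreal (1 - s ^ ?n)"
    proof (cases "s \<in> {0<..<1}")
      case True
      have "compact (homothet K ?b s)"
        using K by (intro compact_homothet) (simp add: convex_body_def)
      then have "- homothet K ?b s \<in> sets (unif K)"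
        by (simp add: setsU borel_compact borel_comp)
      moreover have "(\<integral>\<^sup>+x. ?w s * indicator (- ?G) (s, x) \<partial>unif K)
          = (\<integral>\<^sup>+x. ?w s * indicator (- homothet K ?b s) x \<partial>unif K)"
        using True by (intro nn_integral_cong) (auto simp: mem_homothets_graph split: split_indicator)
      ultimately show ?thesis
        using True emeasure_unif_compl_homothet[OF K barycenter_mem[OF K], of s]
        by (simp add: nn_integral_cmult_indicator)
    qed simp
  qed
  also have "\<dots> = ennreal (a * (\<Sum>k<?n. Beta (real k + 1) (1 - a)))"
    by (rule nn_integral_powr_one_minus_power[OF a])
  also have "1 + \<dots> = ennreal (1 + a * (\<Sum>k<?n. Beta (real k + 1) (1 - a)))"
    using a by (simp add: Beta_def Gamma_real_pos less_imp_le sum_nonneg ennreal_plus)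
  finally show ?thesis
    unfolding sum_Beta_telescope[OF a] .
qed

theorem proposition6p3:
  fixes K :: "(real ^ 'n) set" and a :: real
  assumes "convex_body K" and "0 < a" and "a < 1"
  shows "exp_moment K a \<le> ennreal (2 powr a * Gamma (1 - a) * real CARD('n) powr a)
    \<and> 0 < moment_const a
    \<and> exp_moment K a \<le> ennreal (moment_const a * real CARD('n) powr a)"
proof -
  let ?n = "real CARD('n)"
  have n: "1 \<le> ?n" by (simp add: Suc_leI)
  have G: "0 < Gamma (1 - a)" "0 < Gamma (?n + 1 - a)"
    using assms n by (auto intro!: Gamma_real_pos)
  have "Gamma (?n + 1) \<le> (?n + 1 - a) powr a * Gamma (?n + 1 - a)"
    using Gamma_ratio_le[of a "?n + 1 - a"] assms n by simp
  also have "\<dots> \<le> (2 * ?n) powr a * Gamma (?n + 1 - a)"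
  proof -
    have "0 \<le> ?n + 1 - a" "?n + 1 - a \<le> 2 * ?n"
      using assms n by linarith+
    then show ?thesis
      using assms(2) G by (intro mult_right_mono powr_mono2) auto
  qed
  finally have "Gamma (?n + 1) / Gamma (?n + 1 - a) \<le> 2 powr a * ?n powr a"
    using G by (simp add: divide_simps powr_mult)
  then have "Gamma (1 - a) * (Gamma (?n + 1) / Gamma (?n + 1 - a))
      \<le> Gamma (1 - a) * (2 powr a * ?n powr a)"
    using G by (intro mult_left_mono) auto
  then have "ennreal (Gamma (1 - a) * Gamma (?n + 1) / Gamma (?n + 1 - a))
      \<le> ennreal (2 powr a * Gamma (1 - a) * ?n powr a)"
    by (intro ennreal_leI) (simp add: mult_ac)
  then have "exp_moment K a \<le> ennreal (2 powr a * Gamma (1 - a) * ?n powr a)"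
    using exp_moment_le_Gamma_ratio[OF assms] by (rule order_trans[rotated])
  then show ?thesis
    using G by (simp add: moment_const_def)
qed

end
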